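(* Let $N_1,N_2$ be positive integers, $N=N_1N_2$, let $k\ge 2$ be an integer, and let $\chi_1,\chi_2$ be quadratic Dirichlet characters modulo $N_1,N_2$ respectively. For infinitely many integers $n$, we have $\sigma_{\chi_1,\chi_2}^{k-1}(n)>0$. Similarly, we have $\sigma_{\chi_1,\chi_2}^{k-1}(n)<0$ for infinitely many $n$. In fact, we have $$\lim_{x\to\infty}\frac{1}{x}\cdot\#\{n\le x:(n,N)=1,\ \sigma_{\chi_1,\chi_2}^{k-1}(n)>0\}=\frac12$$ and $$\lim_{x\to\infty}\frac{1}{x}\cdot\#\{n\le x:(n,N)=1,\ \sigma_{\chi_1,\chi_2}^{k-1}(n)<0\}=\frac12.$$
   Context: For Dirichlet characters $\chi_1,\chi_2$ modulo $N_1,N_2$ and an integer $k\ge 2$, define for positive integers $n$ $$\sigma_{\chi_1,\chi_2}^{k-1}(n)=\sum_{d\mid n}\chi_1(n/d)\chi_2(d)d^{k-1}.$$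
   Formalization: Both limits are proved to equal φ(N)/(2N) rather than 1/2: since N>1, the integers coprime to N have density φ(N)/N<1, so the two printed limits cannot both be 1/2; the value 1/2 is the density relative to the integers coprime to N. *)

theory Defs
  imports
    Complex_Main
    "HOL-Library.Complex_Order"
    "HOL-Number_Theory.Totient"
begin

definition dirichlet_char :: "nat \<Rightarrow> (int \<Rightarrow> complex) \<Rightarrow> bool" where
  "dirichlet_char N \<chi> \<longleftrightarrow>
     (\<forall>a. \<chi> (a + int N) = \<chi> a) \<and>
     (\<forall>a b. \<chi> (a * b) = \<chi> a * \<chi> b) \<and>
     (\<forall>a. \<chi> a \<noteq> 0 \<longleftrightarrow> coprime a (int N))"

definition principal_char :: "nat \<Rightarrow> int \<Rightarrow> complex" where
  "principal_char N a = (if coprime a (int N) then 1 else 0)"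

(* Order exactly 2 in the group of characters modulo N; in particular, not principal. *)
definition quadratic_char :: "nat \<Rightarrow> (int \<Rightarrow> complex) \<Rightarrow> bool" where
  "quadratic_char N \<chi> \<longleftrightarrow>
     dirichlet_char N \<chi> \<and> \<chi> \<noteq> principal_char N \<and> (\<forall>a. \<chi> a ^ 2 = principal_char N a)"

(* The exponent m plays the role of k - 1. The values are complex; signs are taken in the
   order of Complex_Order, where 0 < z means that z is real and positive. *)
definition twisted_sigma ::
    "(int \<Rightarrow> complex) \<Rightarrow> (int \<Rightarrow> complex) \<Rightarrow> nat \<Rightarrow> nat \<Rightarrow> complex" where
  "twisted_sigma \<chi>1 \<chi>2 m n =
     (\<Sum>d | d dvd n. \<chi>1 (int (n div d)) * \<chi>2 (int d) * of_nat d ^ m)"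

(* About densities: for n coprime to N = N1 * N2 and m >= 1 the term d = n dominates, so the
   sign of twisted_sigma is the sign of chi2(n). Each sign is therefore taken by half of the
   integers coprime to N. Normalised by x, as in (1/x) * #{n <= x : (n, N) = 1, ...}, this
   is the limit totient N / (2 * N). The limit 1/2, which one finds stated for this
   normalisation, is the density relative to the integers coprime to N; it cannot be meant
   literally, because the two counts together are at most #{n <= x : (n, N) = 1}. *)

end

theory Submission
  imports Defs
begin

text \<open>For \<open>n\<close> coprime to \<open>N\<close>, the sum \<open>twisted_sigma \<chi>1 \<chi>2 m n\<close> is a product over the prime powers
  \<open>p^a\<close> exactly dividing \<open>n\<close>. In the factor at \<open>p^a\<close> the term \<open>\<chi>2 (p^a) p^(a m)\<close> exceeds in
  absolute value the sum of all the others, which is at most a geometric sum. So the sign of the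
  whole sum is \<open>\<chi>2 n\<close>. (The corresponding domination without factoring fails for \<open>m = 1\<close>,
  because of abundant numbers.) Multiplication by a unit \<open>b\<close> modulo \<open>N\<close> with
  \<open>\<chi>2 b = -1\<close> permutes the reduced residues, hence each sign is taken on half of them, and the
  density of a periodic set is its proportion in one period.\<close>

section \<open>The sign of the divisor sum\<close>

text \<open>Every divisor of \<open>a * b\<close> is \<open>c * d\<close> for exactly one pair with
  \<open>c dvd a\<close> and \<open>d dvd b\<close>, since coprimality recovers \<open>c\<close> and
  \<open>d\<close> as the gcds with \<open>a\<close> and \<open>b\<close>. Complete multiplicativity
  then splits each summand along this bijection.\<close>

lemma divisor_convolution_mult_coprime:
  fixes f G :: "nat \<Rightarrow> 'a :: comm_semiring_1"
  assumes f: "\<And>x y. f (x * y) = f x * f y" and G: "\<And>x y. G (x * y) = G x * G y"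
    and "coprime a b"
  shows "(\<Sum>d | d dvd a * b. f (a * b div d) * G d) =
    (\<Sum>d | d dvd a. f (a div d) * G d) * (\<Sum>d | d dvd b. f (b div d) * G d)"
proof -
  have gcd1: "gcd (c * d) a = c" if "c dvd a" "d dvd b" for c d
  proof -
    have "coprime a d" using coprime_divisors [OF dvd_refl that(2) assms(3)] .
    then have "gcd (c * d) a = gcd c a" by (rule gcd_mult_left_right_cancel)
    with that show ?thesis by (simp add: gcd_nat.absorb1)
  qed
  have gcd2: "gcd (c * d) b = d" if "c dvd a" "d dvd b" for c d
  proof -
    have "coprime b c"
      using coprime_divisors [OF that(1) dvd_refl assms(3)] by (simp add: coprime_commute)
    then have "gcd (c * d) b = gcd d b" by (rule gcd_mult_left_left_cancel)
    with that show ?thesis by (simp add: gcd_nat.absorb1)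
  qed
  have "bij_betw (\<lambda>(c, d). c * d) ({d. d dvd a} \<times> {d. d dvd b}) {d. d dvd a * b}"
    unfolding bij_betw_def
  proof
    show "inj_on (\<lambda>(c, d). c * d) ({d. d dvd a} \<times> {d. d dvd b})"
      by (rule inj_on_inverseI [where g = "\<lambda>x. (gcd x a, gcd x b)"]) (auto simp: gcd1 gcd2)
    have "x \<in> (\<lambda>(c, d). c * d) ` ({d. d dvd a} \<times> {d. d dvd b})" if "x dvd a * b" for x
      using division_decomp [OF that] by force
    then show "(\<lambda>(c, d). c * d) ` ({d. d dvd a} \<times> {d. d dvd b}) = {d. d dvd a * b}"
      by (auto intro: mult_dvd_mono)
  qed
  then have "(\<Sum>d | d dvd a * b. f (a * b div d) * G d) =
      (\<Sum>(c, d) \<in> {d. d dvd a} \<times> {d. d dvd b}. f (a * b div (c * d)) * G (c * d))"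
    by (subst sum.reindex_bij_betw [symmetric]) (auto simp: case_prod_unfold)
  also have "\<dots> = (\<Sum>(c, d) \<in> {d. d dvd a} \<times> {d. d dvd b}.
      (f (a div c) * G c) * (f (b div d) * G d))"
    by (intro sum.cong) (auto simp: f G div_mult_div_if_dvd [symmetric] mult_ac)
  also have "\<dots> = (\<Sum>d | d dvd a. f (a div d) * G d) * (\<Sum>d | d dvd b. f (b div d) * G d)"
    by (simp add: sum_product sum.cartesian_product)
  finally show ?thesis .
qed

text \<open>Since \<open>2 * q ^ a \<le> q * q ^ a\<close>, a new top power outweighs everything
  below it. The bound has to hold even at \<open>q = 2\<close>, which occurs for
  \<open>p = 2\<close>, \<open>m = 1\<close>.\<close>

lemma geometric_sum_less_power:
  fixes q :: real
  assumes "q \<ge> 2"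
  shows "(\<Sum>j<a. q ^ j) < q ^ a"
proof (induction a)
  case (Suc a)
  have "2 * q ^ a \<le> q * q ^ a"
    using assms by (intro mult_right_mono) auto
  with Suc show ?case by simp
qed simp

text \<open>With \<open>q = p ^ m\<close>, the divisor \<open>p ^ j\<close> contributes at most
  \<open>q ^ j\<close> in absolute value, and exactly \<open>q ^ a\<close> for \<open>j = a\<close>,
  so the top term beats the geometric sum of the rest. Only a bound on \<open>f\<close> enters:
  \<open>f p\<close> may be 0, as happens for \<open>\<chi>1\<close> when \<open>p\<close> divides
  \<open>N1\<close>.\<close>

lemma twisted_divisor_sum_prime_power_pos:
  fixes f g :: "nat \<Rightarrow> real"
  assumes g: "\<And>x y. g (x * y) = g x * g y" and f_le: "\<And>x. \<bar>f x\<bar> \<le> 1"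
    and f1: "f 1 = 1" and p: "prime p" and gp: "\<bar>g p\<bar> = 1" and "m \<ge> 1"
  shows "(\<Sum>d | d dvd p ^ a. f (p ^ a div d) * (g d * real d ^ m)) * g (p ^ a) > 0"
proof -
  define q where "q = real p ^ m"
  have p1: "p > 1" using p by (rule prime_gt_1_nat)
  then have p0: "p > 0" by simp
  have "real p ^ 1 \<le> q"
    unfolding q_def using p1 \<open>m \<ge> 1\<close> by (intro power_increasing) auto
  then have q2: "q \<ge> 2" using p1 by simp
  \<comment> \<open>\<open>g p = g p * g 1\<close>, and \<open>g p\<close> is nonzero.\<close>
  have g1: "g 1 = 1" using g [of p 1] gp by auto
  have g_pow: "g (p ^ j) = g p ^ j" for j
    by (induction j) (use g1 in \<open>auto simp: g\<close>)
  have abs_g: "\<bar>g (p ^ j)\<bar> = 1" for j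
    by (simp add: g_pow power_abs gp)
  \<comment> \<open>The factor \<open>g (p ^ a)\<close> is a sign; including it in each term makes
    the top term \<open>t a\<close> equal to \<open>q ^ a\<close>, whatever the sign of
    \<open>g (p ^ a)\<close>.\<close>
  define t where "t = (\<lambda>j. f (p ^ (a - j)) * g (p ^ j) * q ^ j * g (p ^ a))"
  have "(\<Sum>d | d dvd p ^ a. f (p ^ a div d) * (g d * real d ^ m)) * g (p ^ a) = (\<Sum>j\<le>a. t j)"
  proof -
    have "{d. d dvd p ^ a} = (\<lambda>j. p ^ j) ` {..a}"
      using divides_primepow_nat [OF p] by auto
    moreover have "inj_on (\<lambda>j. p ^ j) {..a}"
      using p1 by (auto simp: inj_on_def)
    ultimately have "(\<Sum>d | d dvd p ^ a. f (p ^ a div d) * (g d * real d ^ m)) =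
        (\<Sum>j\<le>a. f (p ^ a div p ^ j) * (g (p ^ j) * real (p ^ j) ^ m))"
      by (simp add: sum.reindex)
    also have "\<dots> = (\<Sum>j\<le>a. f (p ^ (a - j)) * g (p ^ j) * q ^ j)"
      using p0 by (intro sum.cong)
        (auto simp: power_diff q_def mult_ac simp flip: power_mult)
    finally show ?thesis by (simp add: sum_distrib_right t_def)
  qed
  also have "(\<Sum>j\<le>a. t j) > 0"
  proof -
    have "\<bar>t j\<bar> \<le> q ^ j" for j
      using mult_right_mono [OF f_le, of "q ^ j"] q2 by (simp add: t_def abs_mult abs_g)
    then have "\<bar>\<Sum>j<a. t j\<bar> \<le> (\<Sum>j<a. q ^ j)"
      by (intro order.trans [OF sum_abs] sum_mono)
    also have "\<dots> < q ^ a" using geometric_sum_less_power [OF q2] .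
    also have "q ^ a = t a"
    proof -
      have "g (p ^ a) * g (p ^ a) = 1"
        using abs_g [of a] by (metis abs_mult_self_eq mult_1)
      then show ?thesis using f1 by (simp add: t_def mult_ac)
    qed
    finally have "\<bar>\<Sum>j<a. t j\<bar> < t a" .
    moreover have "(\<Sum>j\<le>a. t j) = (\<Sum>j<a. t j) + t a"
      by (simp flip: lessThan_Suc_atMost)
    ultimately show ?thesis by linarith
  qed
  finally show ?thesis .
qed

text \<open>The sum times \<open>g n\<close> is multiplicative over coprime factors, so its
  positivity can be built up from prime powers. The induction splits off the full power of one
  prime, which leaves a smaller cofactor coprime to it.\<close>

lemma twisted_divisor_sum_pos:
  fixes f g :: "nat \<Rightarrow> real"
  assumes f: "\<And>x y. f (x * y) = f x * f y" and g: "\<And>x y. g (x * y) = g x * g y"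
    and f_le: "\<And>x. \<bar>f x\<bar> \<le> 1" and one: "f 1 = 1" "g 1 = 1" and m: "m \<ge> 1"
    and "n > 0" and "\<And>p. prime p \<Longrightarrow> p dvd n \<Longrightarrow> \<bar>g p\<bar> = 1"
  shows "(\<Sum>d | d dvd n. f (n div d) * (g d * real d ^ m)) * g n > 0"
  using assms(7,8)
proof (induction n rule: less_induct)
  case (less n)
  show ?case
  proof (cases "n = 1")
    case True
    with one show ?thesis by simp
  next
    case False
    then obtain p where p: "prime p" "p dvd n"
      using prime_factor_nat by blast
    define a where "a = multiplicity p n"
    obtain r where r: "n = p ^ a * r" "\<not> p dvd r"
      using multiplicity_decompose' [of n p] p less.prems not_prime_unit
      unfolding a_def by blast
    have "a > 0" using p r by (cases a) auto
    have "r > 0" using r by (cases r) auto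
    have "1 < p ^ a" using prime_gt_1_nat [OF p(1)] \<open>a > 0\<close> by (rule one_less_power)
    then have "r < n" using r \<open>r > 0\<close> by simp
    have cop: "coprime (p ^ a) r"
      using p r by (simp add: prime_imp_coprime)
    let ?S = "\<lambda>n. \<Sum>d | d dvd n. f (n div d) * (g d * real d ^ m)"
    have "?S r * g r > 0"
      using \<open>r < n\<close> \<open>r > 0\<close> r by (intro less.IH less.prems) auto
    moreover have "?S (p ^ a) * g (p ^ a) > 0"
      using g f_le one p less.prems m by (intro twisted_divisor_sum_prime_power_pos) auto
    moreover have "?S n = ?S (p ^ a) * ?S r"
      unfolding r(1) using cop
      by (intro divisor_convolution_mult_coprime)
        (auto simp: f g power_mult_distrib)
    moreover have "g n = g (p ^ a) * g r"
      by (simp add: r(1) g)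
    ultimately have "?S n * g n = (?S (p ^ a) * g (p ^ a)) * (?S r * g r)"
      by (simp only: mult_ac)
    also have "\<dots> > 0"
      by (rule mult_pos_pos) fact+
    finally show ?thesis .
  qed
qed

section \<open>Equidistribution of a quadratic character\<close>

text \<open>A point where a character modulo \<open>M\<close> equals -1 is at first only a unit
  modulo \<open>M\<close>. To act on the reduced residues modulo \<open>N\<close> it must be moved
  within its class modulo \<open>M\<close> to a unit modulo \<open>N\<close>.\<close>

lemma exists_cong_coprime_mult:
  fixes b :: int
  assumes "coprime b (int M)" "N > 0"
  shows "\<exists>t. coprime (b + t * int M) (int N)"
proof -
  \<comment> \<open>each prime dividing \<open>N\<close> divides exactly one of \<open>b\<close> and \<open>t\<close>\<close>
  define P where "P = {p \<in> prime_factors N. \<not> int p dvd b}"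
  define t where "t = int (\<Prod>P)"
  have "finite P" by (simp add: P_def)
  have primes: "prime p" if "p \<in> P" for p using that by (auto simp: P_def)
  have *: "\<not> int p dvd b + t * int M" if p: "prime p" "p dvd N" for p
  proof (cases "int p dvd b")
    case True
    have "\<not> p dvd M"
    proof
      assume "p dvd M"
      then have "is_unit (int p)"
        using coprime_common_divisor [OF assms(1) True] by simp
      with p(1) show False by simp
    qed
    moreover have "\<not> p dvd \<Prod>P"
    proof
      assume "p dvd \<Prod>P"
      then obtain q where q: "q \<in> P" "p dvd q"
        using prime_dvd_prod_iff [OF \<open>finite P\<close> p(1), of "\<lambda>q. q"] by auto
      then have "p = q" by (intro primes_dvd_imp_eq p(1) primes)
      with q have "p \<in> P" by simp
      with True show False by (simp add: P_def)
    qed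
    ultimately have "\<not> p dvd \<Prod>P * M"
      using p by (simp add: prime_dvd_mult_iff)
    then have "\<not> int p dvd t * int M"
      unfolding t_def by (simp only: of_nat_mult [symmetric] int_dvd_int_iff not_False_eq_True)
    with True show ?thesis by (simp add: dvd_add_right_iff)
  next
    case False
    then have "p \<in> P" using p \<open>N > 0\<close> by (auto simp: P_def prime_factors_dvd)
    then have "p dvd \<Prod>P"
      using dvd_prodI [OF \<open>finite P\<close>, of p "\<lambda>q. q"] by simp
    then have "int p dvd t * int M"
      unfolding t_def by (simp only: int_dvd_int_iff dvd_mult2)
    with False show ?thesis by (simp add: dvd_add_left_iff)
  qed
  have "coprime (b + t * int M) (int N)"
  proof (rule ccontr)
    assume "\<not> coprime (b + t * int M) (int N)"
    then have "gcd (b + t * int M) (int N) \<noteq> 1"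
      by (simp only: coprime_iff_gcd_eq_1 not_False_eq_True)
    then have "nat (gcd (b + t * int M) (int N)) \<noteq> 1"
      by linarith
    then obtain p where "prime p" "p dvd nat (gcd (b + t * int M) (int N))"
      using prime_factor_nat by blast
    then have "int p dvd int (nat (gcd (b + t * int M) (int N)))"
      by (simp only: int_dvd_int_iff)
    then have "int p dvd gcd (b + t * int M) (int N)"
      by (simp only: nat_0_le gcd_ge_0_int)
    then have "int p dvd b + t * int M" "int p dvd int N"
      using dvd_trans gcd_dvd1 gcd_dvd2 by blast+
    then have "int p dvd b + t * int M" "p dvd N"
      by (simp_all only: int_dvd_int_iff)
    with \<open>prime p\<close> * show False by blast
  qed
  then show ?thesis ..
qed

text \<open>Multiplication by \<open>b\<close> negates \<open>g\<close> while permuting the reduced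
  residues, so the sum of \<open>g\<close> over them equals its own negative and vanishes. As
  \<open>1 + s * g x\<close> is 2 where \<open>g x = s\<close> and 0 elsewhere, summing it gives
  twice the count.\<close>

lemma card_totatives_sign:
  fixes g :: "nat \<Rightarrow> real"
  assumes per: "\<And>x. g (x mod N) = g x" and mult: "\<And>x y. g (x * y) = g x * g y"
    and sign: "\<And>x. coprime x N \<Longrightarrow> g x = 1 \<or> g x = -1"
    and b: "coprime b N" "g b = -1" and "N > 1" and s: "s = 1 \<or> s = -1"
  shows "real (card {x \<in> totatives N. g x = s}) = real (totient N) / 2"
proof -
  have b_closed: "(\<lambda>x. b * x mod N) ` totatives N \<subseteq> totatives N"
  proof (rule image_subsetI)
    fix x assume "x \<in> totatives N"
    then have "coprime (b * x mod N) N"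
      using b(1) \<open>N > 1\<close> by (simp add: in_totatives_iff)
    \<comment> \<open>\<open>totatives N\<close> lies in \<open>{0<..N}\<close>, so a residue 0
      would fall outside; for \<open>N > 1\<close> it is not coprime to \<open>N\<close>.\<close>
    moreover from this have "b * x mod N \<noteq> 0"
      using \<open>N > 1\<close> by (intro notI) simp
    ultimately show "b * x mod N \<in> totatives N"
      using \<open>N > 1\<close> by (simp add: in_totatives_iff)
  qed
  have "inj_on (\<lambda>x. b * x mod N) (totatives N)"
  proof (rule inj_onI)
    fix x y assume xy: "x \<in> totatives N" "y \<in> totatives N" "b * x mod N = b * y mod N"
    then have "[x = y] (mod N)"
      using b(1) cong_mult_lcancel_nat [of b N x y] by (simp add: cong_def)
    with xy \<open>N > 1\<close> totatives_less show "x = y" by (simp add: cong_def)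
  qed
  then have bij: "bij_betw (\<lambda>x. b * x mod N) (totatives N) (totatives N)"
    using b_closed by (simp add: bij_betw_def endo_inj_surj)
  have "sum g (totatives N) = (\<Sum>x\<in>totatives N. g (b * x mod N))"
    using sum.reindex_bij_betw [OF bij] by (rule sym)
  also have "\<dots> = - sum g (totatives N)"
    by (simp add: per mult b sum_negf)
  finally have sum0: "sum g (totatives N) = 0" by simp
  have "real (2 * card {x \<in> totatives N. g x = s}) = (\<Sum>x\<in>totatives N. 1 + s * g x)"
  proof -
    have "(\<Sum>x\<in>totatives N. 1 + s * g x) = (\<Sum>x\<in>totatives N. if g x = s then 2 else 0)"
      using s sign by (intro sum.cong) (fastforce simp: in_totatives_iff)+
    then show ?thesis by (simp add: sum.If_cases Int_def)
  qed
  also have "\<dots> = real (totient N)"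
    by (simp add: sum.distrib sum0 totient_def flip: sum_distrib_left)
  finally show ?thesis by simp
qed

section \<open>Densities of periodic sets\<close>

lemma card_periodic_multiple:
  assumes per: "\<And>n. P (n + N) = P n"
  shows "card {n \<in> {0<..q * N}. P n} = q * card {n \<in> {0<..N::nat}. P n}"
proof (induction q)
  case (Suc q)
  \<comment> \<open>The first period is split off; the remaining \<open>q\<close> periods are the
    first \<open>q\<close> periods shifted by \<open>N\<close>.\<close>
  have "{n \<in> {0<..Suc q * N}. P n} =
      {n \<in> {0<..N}. P n} \<union> (\<lambda>n. n + N) ` {n \<in> {0<..q * N}. P n}" (is "_ = ?A \<union> ?B")
  proof (intro set_eqI)
    fix n
    show "n \<in> {n \<in> {0<..Suc q * N}. P n} \<longleftrightarrow> n \<in> ?A \<union> ?B"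
    proof (cases "n \<le> N")
      case False
      then have "n = (n - N) + N" by simp
      with False per [of "n - N"] show ?thesis by (auto simp: image_iff intro!: exI [of _ "n - N"])
    qed auto
  qed
  moreover have "?A \<inter> ?B = {}" by auto
  moreover have "card ?B = card {n \<in> {0<..q * N}. P n}"
    by (intro card_image) (auto simp: inj_on_def)
  ultimately show ?case
    using Suc by (simp add: card_Un_disjoint)
qed simp

text \<open>The integers up to \<open>x\<close> contain \<open>q\<close> full periods,
  \<open>q\<close> being the floor of \<open>x / N\<close>, and are contained in
  \<open>q + 1\<close> of them. The count therefore differs from \<open>c * x / N\<close> by at most
  \<open>c\<close>, an error that vanishes after division by \<open>x\<close>.\<close>

lemma periodic_density:
  assumes per: "\<And>n. P (n + N) = P n" and "N > 0"
  shows "((\<lambda>x :: real. 1 / x * real (card {n :: nat. n > 0 \<and> real n \<le> x \<and> P n})) \<longlongrightarrow>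
    real (card {n \<in> {0<..N}. P n}) / real N) at_top"
proof -
  define c where "c = real (card {n \<in> {0<..N}. P n})"
  define C where "C x = real (card {n :: nat. n > 0 \<and> real n \<le> x \<and> P n})" for x
  have bounds: "c / N - c / x \<le> 1 / x * C x \<and> 1 / x * C x \<le> c / N + c / x" if "x > 0" for x
  proof -
    define q where "q = nat \<lfloor>x / N\<rfloor>"
    have q: "real q \<le> x / N" "x / N < real q + 1"
      using that \<open>N > 0\<close> by (auto simp: q_def)
    have fin: "finite {n :: nat. n > 0 \<and> real n \<le> x \<and> P n}"
      by (rule finite_subset [of _ "{..nat \<lfloor>x\<rfloor>}"]) (auto simp: le_nat_floor)
    have "real (q * N) \<le> x" and "x \<le> real (Suc q * N)"
      using q \<open>N > 0\<close> by (simp_all add: field_simps)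
    then have lo: "{n \<in> {0<..q * N}. P n} \<subseteq> {n. n > 0 \<and> real n \<le> x \<and> P n}"
      and hi: "{n. n > 0 \<and> real n \<le> x \<and> P n} \<subseteq> {n \<in> {0<..Suc q * N}. P n}"
      using of_nat_le_iff [where 'a = real] order.trans
      by (smt (verit) mem_Collect_eq subsetI greaterThanAtMost_iff)+
    have "real (card {n \<in> {0<..q * N}. P n}) \<le> C x" "C x \<le> real (card {n \<in> {0<..Suc q * N}. P n})"
      unfolding C_def using card_mono [OF fin lo] card_mono [OF _ hi] by auto
    then have "real q * c \<le> C x" and "C x \<le> (real q + 1) * c"
      unfolding card_periodic_multiple [of P N, OF per] c_def by (simp_all add: algebra_simps)
    moreover have "(x / N - 1) * c \<le> real q * c" "(real q + 1) * c \<le> (x / N + 1) * c"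
      using q by (auto intro!: mult_right_mono simp: c_def)
    ultimately have "(x / N - 1) * c \<le> C x" "C x \<le> (x / N + 1) * c" by linarith+
    then have "((x / N - 1) * c) / x \<le> C x / x" "C x / x \<le> ((x / N + 1) * c) / x"
      using that by (simp_all only: divide_right_mono less_imp_le)
    moreover have "((x / N - 1) * c) / x = c / N - c / x" "((x / N + 1) * c) / x = c / N + c / x"
      using that by (simp_all add: left_diff_distrib distrib_right diff_divide_distrib add_divide_distrib)
    ultimately show ?thesis by simp
  qed
  have lim: "((\<lambda>x :: real. c / x) \<longlongrightarrow> 0) at_top"
    by (intro tendsto_divide_0 [OF tendsto_const] filterlim_at_top_imp_at_infinity filterlim_ident)
  have "((\<lambda>x. 1 / x * C x) \<longlongrightarrow> c / N) at_top"
  proof (rule tendsto_sandwich)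
    show "\<forall>\<^sub>F x in at_top. c / N - c / x \<le> 1 / x * C x"
      "\<forall>\<^sub>F x in at_top. 1 / x * C x \<le> c / N + c / x"
      using eventually_gt_at_top [of 0] by (eventually_elim, use bounds in blast)+
    show "((\<lambda>x. c / N - c / x) \<longlongrightarrow> c / N) at_top"
      using tendsto_diff [OF tendsto_const [of "c / N"] lim] by simp
    show "((\<lambda>x. c / N + c / x) \<longlongrightarrow> c / N) at_top"
      using tendsto_add [OF tendsto_const [of "c / N"] lim] by simp
  qed
  then show ?thesis by (simp add: C_def c_def)
qed

text \<open>For a finite set the counts stay below a constant \<open>c\<close>, and
  \<open>c / x\<close> tends to 0.\<close>

lemma infinite_if_density_pos:
  assumes lim: "((\<lambda>x :: real. 1 / x * real (card {n :: nat. n > 0 \<and> real n \<le> x \<and> P n})) \<longlongrightarrow> l) at_top"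
    and "l > 0"
  shows "infinite {n. n > 0 \<and> P n}"
proof
  assume fin: "finite {n. n > 0 \<and> P n}"
  define c where "c = real (card {n. n > 0 \<and> P n})"
  have lim0: "((\<lambda>x :: real. c / x) \<longlongrightarrow> 0) at_top"
    by (intro tendsto_divide_0 [OF tendsto_const] filterlim_at_top_imp_at_infinity filterlim_ident)
  have "\<forall>\<^sub>F x in at_top. 1 / x * real (card {n. n > 0 \<and> real n \<le> x \<and> P n}) \<le> c / x"
    using eventually_gt_at_top [of 0]
  proof eventually_elim
    case (elim x)
    have "card {n. n > 0 \<and> real n \<le> x \<and> P n} \<le> card {n. n > 0 \<and> P n}"
      using fin by (intro card_mono) auto
    with elim show ?case by (simp add: c_def divide_right_mono)
  qed
  then have "l \<le> 0"
    using tendsto_le [OF _ lim0 lim] by simp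
  with \<open>l > 0\<close> show False by simp
qed

section \<open>Quadratic characters as real functions\<close>

lemma dirichlet_char_cong:
  assumes "dirichlet_char N \<chi>" "[a = b] (mod int N)"
  shows "\<chi> a = \<chi> b"
proof -
  have step: "\<chi> (x + int N) = \<chi> x" for x
    using assms(1) by (simp add: dirichlet_char_def)
  have "\<chi> (a + int N * k) = \<chi> a" for k
  \<comment> \<open>The definition gives only the shift by one period, so multiples are reached by
    induction upwards and downwards from 0.\<close>
  proof (induction k rule: int_induct [where k = 0])
    case (step1 i)
    then show ?case using step [of "a + int N * i"] by (simp add: algebra_simps)
  next
    case (step2 i)
    then show ?case using step [of "a + int N * (i - 1)"] by (simp add: algebra_simps)
  qed simp
  then show ?thesis using assms(2) by (metis cong_iff_lin)
qed

lemma quadratic_char_cases: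
  assumes "quadratic_char N \<chi>"
  obtains "coprime a (int N)" "\<chi> a = 1" | "coprime a (int N)" "\<chi> a = -1"
    | "\<not> coprime a (int N)" "\<chi> a = 0"
proof -
  have "\<chi> a ^ 2 = (if coprime a (int N) then 1 else 0)"
    using assms by (simp add: quadratic_char_def principal_char_def)
  then show ?thesis using that by (auto simp: power2_eq_1_iff split: if_splits)
qed

lemma quadratic_char_real:
  assumes "quadratic_char N \<chi>"
  shows "\<chi> a = complex_of_real (Re (\<chi> a))" "\<bar>Re (\<chi> a)\<bar> \<le> 1"
    and "coprime a (int N) \<Longrightarrow> Re (\<chi> a) = 1 \<or> Re (\<chi> a) = -1"
  by (cases rule: quadratic_char_cases [OF assms, where a = a]; simp)+

lemma quadratic_char_Re_mult:
  assumes "quadratic_char N \<chi>"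
  shows "Re (\<chi> (a * b)) = Re (\<chi> a) * Re (\<chi> b)"
proof -
  have "\<chi> (a * b) = \<chi> a * \<chi> b"
    using assms by (simp add: quadratic_char_def dirichlet_char_def)
  moreover have "Im (\<chi> a) = 0"
    by (cases rule: quadratic_char_cases [OF assms, where a = a]) simp_all
  ultimately show ?thesis by simp
qed

text \<open>\<open>\<chi> 1\<close> is idempotent, which excludes -1, and 1 is coprime to
  \<open>N\<close>, which excludes 0.\<close>

lemma quadratic_char_Re_one:
  assumes "quadratic_char N \<chi>"
  shows "Re (\<chi> 1) = 1"
proof -
  have "\<chi> 1 * \<chi> 1 = \<chi> (1 * 1)"
    using assms unfolding quadratic_char_def dirichlet_char_def by metis
  then show ?thesis by (cases rule: quadratic_char_cases [OF assms, where a = 1]) simp_all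
qed

text \<open>Non-principality enters here: where \<open>\<chi>\<close> differs from the principal
  character, the values 0 and 1 are excluded, which leaves -1 at a unit.\<close>

lemma quadratic_char_attains_minus_one:
  assumes "quadratic_char N \<chi>"
  obtains b where "coprime b (int N)" "\<chi> b = -1"
proof -
  obtain b where "\<chi> b \<noteq> principal_char N b"
    using assms by (auto simp: quadratic_char_def)
  then have "coprime b (int N) \<and> \<chi> b = -1"
    by (cases rule: quadratic_char_cases [OF assms, where a = b]) (simp_all add: principal_char_def)
  then show ?thesis using that by blast
qed

section \<open>Signs of the twisted divisor sum and their densities\<close>

lemma twisted_sigma_quadratic:
  assumes "quadratic_char N1 \<chi>1" "quadratic_char N2 \<chi>2"
  shows "twisted_sigma \<chi>1 \<chi>2 m n = complex_of_real
    (\<Sum>d | d dvd n. Re (\<chi>1 (int (n div d))) * (Re (\<chi>2 (int d)) * real d ^ m))"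
  unfolding twisted_sigma_def of_real_sum
  by (simp flip: quadratic_char_real(1) [OF assms(1)] quadratic_char_real(1) [OF assms(2)] mult.assoc)

text \<open>Coprimality to \<open>N2\<close> keeps \<open>\<chi>2\<close> nonzero at every prime
  factor of \<open>n\<close>. The real sum times the sign \<open>\<chi>2 n\<close> is then positive,
  so the two signs agree.\<close>

lemma twisted_sigma_sign:
  assumes "quadratic_char N1 \<chi>1" "quadratic_char N2 \<chi>2" "m \<ge> 1" "n > 0" "coprime n N2"
  shows "twisted_sigma \<chi>1 \<chi>2 m n > 0 \<longleftrightarrow> Re (\<chi>2 (int n)) = 1"
    and "twisted_sigma \<chi>1 \<chi>2 m n < 0 \<longleftrightarrow> Re (\<chi>2 (int n)) = -1"
proof -
  define S where
    "S = (\<Sum>d | d dvd n. Re (\<chi>1 (int (n div d))) * (Re (\<chi>2 (int d)) * real d ^ m))"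
  have "S * Re (\<chi>2 (int n)) > 0"
    unfolding S_def
  proof (intro twisted_divisor_sum_pos)
    fix p assume "prime p" "p dvd n"
    then have "coprime p N2"
      using assms(5) coprime_divisors dvd_refl by blast
    then have "coprime (int p) (int N2)" by simp
    with quadratic_char_real(3) [OF assms(2)] show "\<bar>Re (\<chi>2 (int p))\<bar> = 1" by fastforce
  qed (use assms quadratic_char_real(2) quadratic_char_Re_mult quadratic_char_Re_one in auto)
  moreover have "Re (\<chi>2 (int n)) = 1 \<or> Re (\<chi>2 (int n)) = -1"
    using quadratic_char_real(3) [OF assms(2)] assms(5) by simp
  moreover have "twisted_sigma \<chi>1 \<chi>2 m n = complex_of_real S"
    unfolding S_def by (rule twisted_sigma_quadratic [OF assms(1,2)])
  ultimately show "twisted_sigma \<chi>1 \<chi>2 m n > 0 \<longleftrightarrow> Re (\<chi>2 (int n)) = 1"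
    and "twisted_sigma \<chi>1 \<chi>2 m n < 0 \<longleftrightarrow> Re (\<chi>2 (int n)) = -1"
    \<comment> \<open>A strict inequality in this order requires equal imaginary parts, which holds
      because the sum is \<open>complex_of_real S\<close>.\<close>
    by (auto simp: less_complex_def)
qed

text \<open>Since \<open>M dvd N\<close>, both conditions on \<open>n\<close> are periodic modulo
  \<open>N\<close>, and half of the reduced residues in one period satisfy them.\<close>

lemma quadratic_char_sign_density:
  assumes "quadratic_char M \<chi>" "M dvd N" "N > 0" "s = 1 \<or> s = -1"
  shows "((\<lambda>x :: real. 1 / x * real (card {n :: nat. n > 0 \<and> real n \<le> x \<and>
      coprime n N \<and> Re (\<chi> (int n)) = s})) \<longlongrightarrow> 1 / 2 * (real (totient N) / real N)) at_top"
proof -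
  define g where "g = (\<lambda>n. Re (\<chi> (int n)))"
  have cong: "\<chi> a = \<chi> b" if "[a = b] (mod int N)" for a b
    using dirichlet_char_cong [of M \<chi> a b] cong_dvd_modulus [OF that] assms(1,2)
    by (simp add: quadratic_char_def)
  have g_mod: "g (x mod N) = g x" for x
    unfolding g_def by (intro arg_cong [where f = Re] cong) (simp add: cong_def of_nat_mod)
  obtain b0 where b0: "coprime b0 (int M)" "\<chi> b0 = -1"
    using quadratic_char_attains_minus_one [OF assms(1)] by blast
  obtain t where t: "coprime (b0 + t * int M) (int N)"
    using exists_cong_coprime_mult [OF b0(1) assms(3)] by blast
  \<comment> \<open>Adding \<open>t * int M\<close> preserves the value of \<open>\<chi>\<close>,
    and so does reduction modulo \<open>N\<close>; the result is a natural number that is a unit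
    modulo \<open>N\<close> with value -1.\<close>
  define b where "b = nat ((b0 + t * int M) mod int N)"
  have int_b: "int b = (b0 + t * int M) mod int N"
    using \<open>N > 0\<close> by (simp add: b_def)
  have "coprime (int b) (int N)"
    unfolding int_b using t \<open>N > 0\<close> by simp
  then have b: "coprime b N" by simp
  have "\<chi> (int b) = \<chi> (b0 + t * int M)"
    unfolding int_b by (intro cong) (simp add: cong_def)
  also have "\<dots> = \<chi> b0"
    using assms(1) by (intro dirichlet_char_cong [of M]) (auto simp: quadratic_char_def cong_def)
  finally have gb: "g b = -1" by (simp add: g_def b0)
  \<comment> \<open>Modulo 1 all residues coincide, which would give \<open>g b = g 1\<close>, that
    is, -1 = 1.\<close>
  have "N \<noteq> 1"
    using g_mod [of b] g_mod [of 1] gb quadratic_char_Re_one [OF assms(1)] by (auto simp: g_def)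
  with \<open>N > 0\<close> have "N > 1" by simp
  have "g x = 1 \<or> g x = -1" if "coprime x N" for x
  proof -
    have "coprime x M" using that assms(2) coprime_divisors dvd_refl by blast
    then show ?thesis using quadratic_char_real(3) [OF assms(1), of "int x"] by (simp add: g_def)
  qed
  then have "real (card {x \<in> totatives N. g x = s}) = real (totient N) / 2"
    using g_mod b gb \<open>N > 1\<close> assms(4) quadratic_char_Re_mult [OF assms(1)]
    by (intro card_totatives_sign) (auto simp: g_def)
  moreover have "{x \<in> totatives N. g x = s} = {n \<in> {0<..N}. coprime n N \<and> g n = s}"
    by (auto simp: in_totatives_iff)
  ultimately have card_eq:
    "real (card {n \<in> {0<..N}. coprime n N \<and> g n = s}) = real (totient N) / 2"
    by (simp only:)
  have "g (n + N) = g n" for n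
    using g_mod [of n] g_mod [of "n + N"] by simp
  moreover have "coprime (n + N) N = coprime n N" for n
    by (simp only: coprime_iff_gcd_eq_1 gcd_add1)
  ultimately have "((\<lambda>x :: real. 1 / x * real (card {n :: nat. n > 0 \<and> real n \<le> x \<and>
      coprime n N \<and> g n = s})) \<longlongrightarrow> (real (totient N) / 2) / real N) at_top"
    using periodic_density [of "\<lambda>n. coprime n N \<and> g n = s" N] \<open>N > 0\<close>
    unfolding card_eq by simp
  then show ?thesis by (simp add: g_def)
qed

theorem corollary3p2:
  fixes N1 N2 N k :: nat and \<chi>1 \<chi>2 :: "int \<Rightarrow> complex"
  assumes "N1 > 0" and "N2 > 0" and "N = N1 * N2" and "k \<ge> 2"
    and "quadratic_char N1 \<chi>1" and "quadratic_char N2 \<chi>2"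
  shows "infinite {n :: nat. n > 0 \<and> twisted_sigma \<chi>1 \<chi>2 (k - 1) n > 0} \<and>
    infinite {n :: nat. n > 0 \<and> twisted_sigma \<chi>1 \<chi>2 (k - 1) n < 0} \<and>
    ((\<lambda>x :: real. 1 / x * real (card {n :: nat. n > 0 \<and> real n \<le> x \<and> coprime n N \<and>
        twisted_sigma \<chi>1 \<chi>2 (k - 1) n > 0})) \<longlongrightarrow> 1 / 2 * (real (totient N) / real N)) at_top \<and>
    ((\<lambda>x :: real. 1 / x * real (card {n :: nat. n > 0 \<and> real n \<le> x \<and> coprime n N \<and>
        twisted_sigma \<chi>1 \<chi>2 (k - 1) n < 0})) \<longlongrightarrow> 1 / 2 * (real (totient N) / real N)) at_top"
proof -
  have N: "N > 0" "N2 dvd N" using assms by auto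
  have pos: "n > 0 \<and> real n \<le> x \<and> coprime n N \<and> twisted_sigma \<chi>1 \<chi>2 (k - 1) n > 0 \<longleftrightarrow>
      n > 0 \<and> real n \<le> x \<and> coprime n N \<and> Re (\<chi>2 (int n)) = 1"
    and neg: "n > 0 \<and> real n \<le> x \<and> coprime n N \<and> twisted_sigma \<chi>1 \<chi>2 (k - 1) n < 0 \<longleftrightarrow>
      n > 0 \<and> real n \<le> x \<and> coprime n N \<and> Re (\<chi>2 (int n)) = -1" for n x
    using twisted_sigma_sign [OF assms(5,6), of "k - 1" n] assms(3,4) by auto
  have lim_pos: "((\<lambda>x :: real. 1 / x * real (card {n :: nat. n > 0 \<and> real n \<le> x \<and> coprime n N \<and>
      twisted_sigma \<chi>1 \<chi>2 (k - 1) n > 0})) \<longlongrightarrow> 1 / 2 * (real (totient N) / real N)) at_top"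
    unfolding pos using quadratic_char_sign_density [OF assms(6) N(2,1), of 1] by simp
  have lim_neg: "((\<lambda>x :: real. 1 / x * real (card {n :: nat. n > 0 \<and> real n \<le> x \<and> coprime n N \<and>
      twisted_sigma \<chi>1 \<chi>2 (k - 1) n < 0})) \<longlongrightarrow> 1 / 2 * (real (totient N) / real N)) at_top"
    unfolding neg using quadratic_char_sign_density [OF assms(6) N(2,1), of "-1"] by simp
  \<comment> \<open>Positivity of \<open>totient N\<close> makes both densities positive, so each
    sign occurs infinitely often already among the \<open>n\<close> coprime to
    \<open>N\<close>.\<close>
  have "1 / 2 * (real (totient N) / real N) > 0" using N by simp
  then have "infinite {n. n > 0 \<and> coprime n N \<and> twisted_sigma \<chi>1 \<chi>2 (k - 1) n > 0}"
    and "infinite {n. n > 0 \<and> coprime n N \<and> twisted_sigma \<chi>1 \<chi>2 (k - 1) n < 0}"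
    using infinite_if_density_pos [OF lim_pos] infinite_if_density_pos [OF lim_neg] by blast+
  then have "infinite {n. n > 0 \<and> twisted_sigma \<chi>1 \<chi>2 (k - 1) n > 0}"
    and "infinite {n. n > 0 \<and> twisted_sigma \<chi>1 \<chi>2 (k - 1) n < 0}"
    by (auto elim: contrapos_nn intro: finite_subset [rotated])
  with lim_pos lim_neg show ?thesis by blast
qed

end
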